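(* For any finite acyclic digraph $\vec H$, the isometric Ramsey number $\mathrm{IR}(\vec H)$ is finite; that is, there exists a finite graph $G$ such that $G\Rightarrow \vec H$.
   Context: Graphs are simple and undirected. A digraph $\vec G=(V_{\vec G},E_{\vec G})$ has $E_{\vec G}\subset V_{\vec G}\times V_{\vec G}$ with neither loops nor pairs of opposite arcs. It is acyclic if it contains no directed cycles. An orientation $\vec G$ of a graph $G$ is a digraph on $V_G$ obtained by replacing each edge $\{a,b\}$ by exactly one of $(a,b)$, $(b,a)$. The distance $d_G(u,v)$ is the smallest number of edges of a path in $G$ joining $u$ and $v$ ($\infty$ if there is none); distance in a digraph is the distance in its underlying undirected graph. For a graph $G$ and a digraph $\vec H$, $G\Rightarrow\vec H$ means: for every orientation $\vec G$ of $G$ there is an injective map $f:V_{\vec H}\to V_G$ such that (i) for all $u,v\in V_{\vec H}$, $(u,v)\in E_{\vec H}$ if and only if $(f(u),f(v))\in E_{\vec G}$, and (ii) $d_{\vec H}(u,v)=d_G(f(u),f(v))$ for all $u,v\in V_{\vec H}$. $\mathrm{IR}(\vec H)$ is the smallest number of vertices of a graph $G$ with $G\Rightarrow\vec H$ ($\infty$ if no such graph exists). *)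

theory Defs
  imports "Graph_Theory.Graph_Theory" "HOL-Library.Extended_Nat"
begin

text \<open>
  As in Graph_Theory, an undirected simple graph is a symmetric loop-free digraph: the
  edge \<open>{a,b}\<close> is the pair of arcs \<open>(a,b)\<close>, \<open>(b,a)\<close>.  Finite simple graphs are thus the
  models of the locale \<open>pair_graph\<close>, and finite loop-free digraphs those of \<open>pair_digraph\<close>.
\<close>

definition finite_oriented_digraph :: "'a pair_pre_digraph \<Rightarrow> bool" where
  "finite_oriented_digraph H \<longleftrightarrow>
     pair_digraph H \<and> (\<forall>u v. (u, v) \<in> parcs H \<longrightarrow> (v, u) \<notin> parcs H)"

definition acyclic_digraph :: "'a pair_pre_digraph \<Rightarrow> bool" where
  "acyclic_digraph H \<longleftrightarrow> (\<nexists>c. pre_digraph.cycle (with_proj H) c)"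

definition orientation :: "'a pair_pre_digraph \<Rightarrow> 'a pair_pre_digraph \<Rightarrow> bool" where
  "orientation G D \<longleftrightarrow>
     pverts D = pverts G \<and> parcs D \<subseteq> parcs G \<and>
     (\<forall>(a, b) \<in> parcs G. (a, b) \<in> parcs D \<longleftrightarrow> (b, a) \<notin> parcs D)"

text \<open>The infimum over the empty set is \<open>\<infinity>\<close>, which is the distance when no path exists.\<close>

definition graph_dist :: "'a pair_pre_digraph \<Rightarrow> 'a \<Rightarrow> 'a \<Rightarrow> enat" where
  "graph_dist G u v =
     (INF p \<in> {p. vpath p (with_proj G) \<and> hd p = u \<and> last p = v}. enat (vwalk_length p))"

definition digraph_dist :: "'a pair_pre_digraph \<Rightarrow> 'a \<Rightarrow> 'a \<Rightarrow> enat" where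
  "digraph_dist H = graph_dist (mk_symmetric (with_proj H))"

definition isometric_arrow :: "'a pair_pre_digraph \<Rightarrow> 'b pair_pre_digraph \<Rightarrow> bool" where
  "isometric_arrow G H \<longleftrightarrow>
     (\<forall>D. orientation G D \<longrightarrow>
       (\<exists>f. f \<in> pverts H \<rightarrow> pverts G \<and> inj_on f (pverts H) \<and>
          (\<forall>u \<in> pverts H. \<forall>v \<in> pverts H. (u, v) \<in> parcs H \<longleftrightarrow> (f u, f v) \<in> parcs D) \<and>
          (\<forall>u \<in> pverts H. \<forall>v \<in> pverts H. digraph_dist H u v = graph_dist G (f u) (f v))))"

text \<open>
  Every finite graph has an isomorphic copy on natural numbers and infinite graphs do not
  contribute to the minimum, so it is taken over the finite graphs with vertices in \<open>nat\<close>.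
\<close>

definition IR :: "'b pair_pre_digraph \<Rightarrow> enat" where
  "IR H = (INF G \<in> {G :: nat pair_pre_digraph. pair_graph G \<and> isometric_arrow G H}.
             enat (card (pverts G)))"

end

theory Submission
  imports Defs "HOL-Library.Countable"
begin

text \<open>
  A copy of \<open>H\<close> in \<open>G\<close> is isometric as soon as \<open>G\<close> retracts onto it by a map that sends
  every edge to an edge or to a single vertex; such retract embeddings compose.  Place the vertices
  of a graph on levels.  Repeated use of the Hales--Jewett theorem, once per pair of levels, gives a
  graph each of whose orientations contains a retract copy of the given one in which any two
  levels are joined in one direction only.  Apply this to disjoint copies of \<open>H\<close>, one for every
  injective placement of its vertices on \<open>2 ^ |H|\<close> levels: the directions between levels form a
  tournament, which has a transitive subtournament on \<open>|H|\<close> levels, and the copy of \<open>H\<close>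
  placed there in topological order is oriented as required.
\<close>

section \<open>The Hales--Jewett theorem\<close>

text \<open>Combinatorial lines are coded as words over \<open>'a option\<close>:
  \<open>None\<close> marks the moving coordinates, and \<open>x\<close> is the parameter of a point
  on the line.\<close>

definition inst :: "'a \<Rightarrow> 'a option list \<Rightarrow> 'a list" where
  "inst x L = map (case_option x id) L"

definition lines :: "'a set \<Rightarrow> nat \<Rightarrow> 'a option list set" where
  "lines A n = {L. length L = n \<and> None \<in> set L \<and> set L \<subseteq> insert None (Some ` A)}"

lemma finite_lines: "finite A \<Longrightarrow> finite (lines A n)"
  by (rule finite_subset[OF _ finite_lists_length_eq[of "insert None (Some ` A)" n]])
    (auto simp: lines_def)

lemma lines_mono: "A \<subseteq> B \<Longrightarrow> lines A n \<subseteq> lines B n"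
  by (auto simp: lines_def)

lemma inst_append [simp]: "inst x (L @ M) = inst x L @ inst x M"
  by (simp add: inst_def)

lemma inst_map_Some [simp]: "inst x (map Some w) = w"
  by (induction w) (auto simp: inst_def)

lemma set_inst: "L \<in> lines A n \<Longrightarrow> x \<in> A \<Longrightarrow> set (inst x L) \<subseteq> A"
  by (auto simp: lines_def inst_def split: option.splits)

lemma length_inst: "L \<in> lines A n \<Longrightarrow> length (inst x L) = n"
  by (auto simp: lines_def inst_def)

lemma lines_append:
  assumes "L \<in> lines A m" "M \<in> lines A n"
  shows "L @ M \<in> lines A (m + n)"
  using assms by (auto simp: lines_def)

lemma lines_append_word:
  assumes "L \<in> lines A m" "length w = n" "set w \<subseteq> A"
  shows "L @ map Some w \<in> lines A (m + n)" "map Some w @ L \<in> lines A (n + m)"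
  using assms by (auto simp: lines_def)

definition mono_line :: "'a set \<Rightarrow> nat \<Rightarrow> ('a list \<Rightarrow> nat) \<Rightarrow> bool" where
  "mono_line A n \<chi> \<longleftrightarrow> (\<exists>L \<in> lines A n. \<exists>c. \<forall>x \<in> A. \<chi> (inst x L) = c)"

text \<open>Colour focusing: \<open>w\<close> completes every one of these lines, so if no line is monochromatic then its
  colour is not in \<open>C\<close>; this is impossible once \<open>C\<close> contains all colours.\<close>

definition focused :: "'a \<Rightarrow> 'a set \<Rightarrow> nat \<Rightarrow> ('a list \<Rightarrow> nat) \<Rightarrow> 'a list \<Rightarrow> nat set \<Rightarrow> bool" where
  "focused a A n \<chi> w C \<longleftrightarrow> length w = n \<and> set w \<subseteq> insert a A \<and>
     (\<forall>c \<in> C. \<exists>L \<in> lines (insert a A) n. inst a L = w \<and> (\<forall>x \<in> A. \<chi> (inst x L) = c))"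

text \<open>The line belonging to the colour of \<open>w\<close> already has that colour at every
  letter of \<open>A\<close>, and \<open>w\<close> is its point at \<open>a\<close>.\<close>

lemma mono_line_focused:
  assumes "focused a A n \<chi> w C" "\<chi> w \<in> C"
  shows "mono_line (insert a A) n \<chi>"
  using assms unfolding focused_def mono_line_def by (metis insertE)

text \<open>Induction on the number \<open>s\<close> of focused colours: a block of new coordinates
  either yields a monochromatic line or adds the colour of the old focus to
  \<open>C\<close>.\<close>

lemma hales_jewett_focusing:
  assumes fin: "finite A"
    and HJ: "\<And>r. \<exists>n. \<forall>\<chi>. (\<forall>w. \<chi> w < r) \<longrightarrow> mono_line A n \<chi>"
    and x0: "x0 \<in> A"
  shows "\<exists>n. \<forall>\<chi>. (\<forall>w. \<chi> w < r) \<longrightarrow>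
           mono_line (insert a A) n \<chi> \<or>
           (\<exists>w C. focused a A n \<chi> w C \<and> card C = s \<and> C \<subseteq> {..<r} \<and> \<chi> w \<notin> C)"
proof (induction s)
  case 0
  show ?case
    by (rule exI[of _ 0]) (auto simp: focused_def intro!: exI[of _ "{}"])
next
  case (Suc s)
  then obtain m where m: "\<And>\<chi>. (\<forall>w. \<chi> w < r) \<Longrightarrow>
           mono_line (insert a A) m \<chi> \<or>
           (\<exists>w C. focused a A m \<chi> w C \<and> card C = s \<and> C \<subseteq> {..<r} \<and> \<chi> w \<notin> C)"
    by blast
  define W where "W = {w. set w \<subseteq> insert a A \<and> length w = m}"
  have "finite W"
    unfolding W_def using fin by (intro finite_lists_length_eq) auto
  then have "finite (W \<rightarrow>\<^sub>E {..<r})"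
    by (intro finite_PiE) auto
  \<comment> \<open>\<open>h\<close> numbers the \<open>r\<close>-colourings of \<open>W\<close>, so
    the way a suffix colours all prefixes becomes one colour below \<open>N\<close>, to which
    Hales-Jewett over \<open>A\<close> applies.\<close>
  then obtain h :: "('a list \<Rightarrow> nat) \<Rightarrow> nat" and N where
    h: "h ` (W \<rightarrow>\<^sub>E {..<r}) = {i. i < N}" "inj_on h (W \<rightarrow>\<^sub>E {..<r})"
    using finite_imp_inj_to_nat_seg[of "W \<rightarrow>\<^sub>E {..<r}"] by blast
  obtain k where k: "\<And>\<chi>. (\<forall>w. \<chi> w < N) \<Longrightarrow> mono_line A k \<chi>"
    using HJ by blast
  show ?case
  proof (intro exI[of _ "m + k"] allI impI)
    fix \<chi> :: "'a list \<Rightarrow> nat"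
    assume \<chi>: "\<forall>w. \<chi> w < r"
    define g where "g v = restrict (\<lambda>u. \<chi> (u @ v)) W" for v
    have g: "g v \<in> W \<rightarrow>\<^sub>E {..<r}" for v
      using \<chi> by (auto simp: g_def)
    have "\<forall>v. h (g v) < N"
      using g h(1) by blast
    then obtain M c where M: "M \<in> lines A k" "\<forall>x \<in> A. h (g (inst x M)) = c"
      using k[of "\<lambda>v. h (g v)"] unfolding mono_line_def by blast
    have M': "M \<in> lines (insert a A) k"
      using M(1) lines_mono[OF subset_insertI] by (rule rev_subsetD)
    define v where "v = inst x0 M"
    define \<chi>' where "\<chi>' u = \<chi> (u @ v)" for u
    \<comment> \<open>Moving along \<open>M\<close> within \<open>A\<close> leaves the colour of
      every extended prefix unchanged; at \<open>a\<close> it may differ.\<close>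
    have eq: "\<chi> (u @ inst x M) = \<chi>' u" if "x \<in> A" "u \<in> W" for x u
    proof -
      have "g (inst x M) = g v"
        using M(2) x0 that(1) g unfolding v_def by (intro inj_onD[OF h(2)]) auto
      then have "g (inst x M) u = g v u"
        by simp
      then show ?thesis
        using that(2) by (simp add: g_def \<chi>'_def)
    qed
    have v: "length v = k" "set v \<subseteq> insert a A"
      using M(1) x0 set_inst[OF M(1) x0] by (auto simp: v_def length_inst)
    have "\<forall>w. \<chi>' w < r"
      using \<chi> by (simp add: \<chi>'_def)
    from m[OF this] show "mono_line (insert a A) (m + k) \<chi> \<or>
           (\<exists>w C. focused a A (m + k) \<chi> w C \<and> card C = Suc s \<and> C \<subseteq> {..<r} \<and> \<chi> w \<notin> C)"
    proof
      assume "mono_line (insert a A) m \<chi>'"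
      then obtain L c where "L \<in> lines (insert a A) m" "\<forall>x \<in> insert a A. \<chi>' (inst x L) = c"
        unfolding mono_line_def by blast
      then show ?thesis
        unfolding mono_line_def using lines_append_word(1)[OF _ v]
        by (intro disjI1 bexI[of _ "L @ map Some v"] exI[of _ c]) (auto simp: \<chi>'_def)
    next
      assume "\<exists>w C. focused a A m \<chi>' w C \<and> card C = s \<and> C \<subseteq> {..<r} \<and> \<chi>' w \<notin> C"
      then obtain w C where w: "length w = m" "set w \<subseteq> insert a A"
        and lin: "\<And>c. c \<in> C \<Longrightarrow> \<exists>L \<in> lines (insert a A) m. inst a L = w \<and> (\<forall>x \<in> A. \<chi>' (inst x L) = c)"
        and C: "card C = s" "C \<subseteq> {..<r}" "\<chi>' w \<notin> C"
        unfolding focused_def by blast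
      have wW: "w \<in> W"
        using w by (simp add: W_def)
      \<comment> \<open>The new focus is the old one followed by the point of \<open>M\<close> at
        \<open>a\<close>. Freezing \<open>w\<close> and moving along \<open>M\<close> gives the new
        colour; moving along \<open>L\<close> and \<open>M\<close> together keeps each old
        colour.\<close>
      have foc: "focused a A (m + k) \<chi> (w @ inst a M) (insert (\<chi>' w) C)"
        unfolding focused_def
      proof (intro conjI ballI)
        show "length (w @ inst a M) = m + k"
          using w M by (simp add: length_inst)
        show "set (w @ inst a M) \<subseteq> insert a A"
          using w set_inst[OF M'] by simp
        fix c assume "c \<in> insert (\<chi>' w) C"
        then consider "c = \<chi>' w" | "c \<in> C"
          by blast
        then show "\<exists>L \<in> lines (insert a A) (m + k). inst a L = w @ inst a M \<and> (\<forall>x \<in> A. \<chi> (inst x L) = c)"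
        proof cases
          case 1
          then show ?thesis
            using lines_append_word(2)[OF M' w] eq wW
            by (intro bexI[of _ "map Some w @ M"]) auto
        next
          case 2
          from lin[OF this] obtain L where L: "L \<in> lines (insert a A) m" "inst a L = w"
            "\<forall>x \<in> A. \<chi>' (inst x L) = c"
            by blast
          have "inst x L \<in> W" if "x \<in> A" for x
            using set_inst[OF L(1), of x] length_inst[OF L(1)] that by (simp add: W_def)
          then show ?thesis
            using lines_append[OF L(1) M'] L eq by (intro bexI[of _ "L @ M"]) auto
        qed
      qed
      have "finite C"
        using C(2) finite_subset by blast
      then have "card (insert (\<chi>' w) C) = Suc s" "insert (\<chi>' w) C \<subseteq> {..<r}"
        using C \<chi> by (auto simp: \<chi>'_def)
      then show ?thesis
        using foc mono_line_focused[OF foc] by blast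
    qed
  qed
qed

text \<open>Induction on the alphabet. Focusing \<open>r\<close> out of \<open>r\<close> colours
  leaves none for the focus, so only the monochromatic alternative survives.\<close>

lemma hales_jewett:
  assumes "finite A"
  shows "\<exists>n. \<forall>\<chi>. (\<forall>w. \<chi> w < r) \<longrightarrow> mono_line A n \<chi>"
  using assms
proof (induction A arbitrary: r rule: finite_induct)
  case empty
  \<comment> \<open>Over the empty alphabet the line \<open>[None]\<close> has no points, so it is
    vacuously monochromatic.\<close>
  show ?case
    by (rule exI[of _ 1]) (auto simp: mono_line_def lines_def intro!: exI[of _ "[None]"])
next
  case (insert a A)
  show ?case
  proof (cases "A = {}")
    case True
    then show ?thesis
      by (intro exI[of _ 1]) (auto simp: mono_line_def lines_def intro!: exI[of _ "[None]"])
  next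
    case False
    then obtain x0 where "x0 \<in> A"
      by blast
    from hales_jewett_focusing[OF insert.hyps(1) insert.IH this, of r a r] obtain n where
      n: "\<And>\<chi>. (\<forall>w. \<chi> w < r) \<Longrightarrow> mono_line (insert a A) n \<chi> \<or>
           (\<exists>w C. focused a A n \<chi> w C \<and> card C = r \<and> C \<subseteq> {..<r} \<and> \<chi> w \<notin> C)"
      by blast
    have "mono_line (insert a A) n \<chi>" if \<chi>: "\<forall>w. \<chi> w < r" for \<chi>
    proof -
      have False if "card C = r" "C \<subseteq> {..<r}" "\<chi> w \<notin> C" for w C
        using card_subset_eq[of "{..<r}" C] that \<chi> by auto
      then show ?thesis
        using n[OF \<chi>] by blast
    qed
    then show ?thesis
      by blast
  qed
qed

section \<open>Retracts and distances\<close>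

text \<open>The retraction may collapse an edge to a vertex: this still cannot increase distances,
  and coordinate projections do collapse edges.\<close>

definition retract_embedding :: "'a pair_pre_digraph \<Rightarrow> 'b pair_pre_digraph \<Rightarrow> ('a \<Rightarrow> 'b) \<Rightarrow> bool" where
  "retract_embedding G K f \<longleftrightarrow>
     f \<in> pverts G \<rightarrow> pverts K \<and> (\<forall>(u, v) \<in> parcs G. (f u, f v) \<in> parcs K) \<and>
     (\<exists>\<rho>. \<rho> \<in> pverts K \<rightarrow> pverts G \<and> (\<forall>v \<in> pverts G. \<rho> (f v) = v) \<and>
        (\<forall>(x, y) \<in> parcs K. \<rho> x = \<rho> y \<or> (\<rho> x, \<rho> y) \<in> parcs G))"

lemma retract_embeddingE:
  assumes "retract_embedding G K f"
  obtains \<rho> where "\<And>v. v \<in> pverts G \<Longrightarrow> f v \<in> pverts K"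
    "\<And>u v. (u, v) \<in> parcs G \<Longrightarrow> (f u, f v) \<in> parcs K"
    "\<And>x. x \<in> pverts K \<Longrightarrow> \<rho> x \<in> pverts G"
    "\<And>v. v \<in> pverts G \<Longrightarrow> \<rho> (f v) = v"
    "\<And>x y. (x, y) \<in> parcs K \<Longrightarrow> \<rho> x = \<rho> y \<or> (\<rho> x, \<rho> y) \<in> parcs G"
  using assms unfolding retract_embedding_def by fast

lemma retract_embeddingI:
  assumes "\<And>v. v \<in> pverts G \<Longrightarrow> f v \<in> pverts K"
    "\<And>u v. (u, v) \<in> parcs G \<Longrightarrow> (f u, f v) \<in> parcs K"
    "\<And>x. x \<in> pverts K \<Longrightarrow> \<rho> x \<in> pverts G"
    "\<And>v. v \<in> pverts G \<Longrightarrow> \<rho> (f v) = v"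
    "\<And>x y. (x, y) \<in> parcs K \<Longrightarrow> \<rho> x = \<rho> y \<or> (\<rho> x, \<rho> y) \<in> parcs G"
  shows "retract_embedding G K f"
  unfolding retract_embedding_def using assms by (intro conjI exI[of _ \<rho>]) (auto, blast)

lemma retract_embedding_inj_on:
  assumes "retract_embedding G K f"
  shows "inj_on f (pverts G)"
  using assms by (elim retract_embeddingE) (rule inj_on_inverseI)

text \<open>Applying the retraction to the arc shows that the copy is induced.\<close>

lemma retract_embedding_arcD:
  assumes "retract_embedding G K f" "u \<in> pverts G" "v \<in> pverts G" "(f u, f v) \<in> parcs K"
  shows "u = v \<or> (u, v) \<in> parcs G"
  using assms(1)
proof (rule retract_embeddingE)
  fix \<rho> assume "\<And>v. v \<in> pverts G \<Longrightarrow> \<rho> (f v) = v"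
    "\<And>x y. (x, y) \<in> parcs K \<Longrightarrow> \<rho> x = \<rho> y \<or> (\<rho> x, \<rho> y) \<in> parcs G"
  from this(2)[OF assms(4)] this(1)[OF assms(2)] this(1)[OF assms(3)] show ?thesis
    by simp
qed

lemma retract_embedding_comp:
  assumes "retract_embedding G K f" "retract_embedding K M g"
  shows "retract_embedding G M (\<lambda>v. g (f v))"
proof -
  obtain \<rho> where \<rho>: "\<And>v. v \<in> pverts G \<Longrightarrow> f v \<in> pverts K"
    "\<And>u v. (u, v) \<in> parcs G \<Longrightarrow> (f u, f v) \<in> parcs K"
    "\<And>x. x \<in> pverts K \<Longrightarrow> \<rho> x \<in> pverts G"
    "\<And>v. v \<in> pverts G \<Longrightarrow> \<rho> (f v) = v"
    "\<And>x y. (x, y) \<in> parcs K \<Longrightarrow> \<rho> x = \<rho> y \<or> (\<rho> x, \<rho> y) \<in> parcs G"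
    using assms(1) by (rule retract_embeddingE) blast
  obtain \<sigma> where \<sigma>: "\<And>v. v \<in> pverts K \<Longrightarrow> g v \<in> pverts M"
    "\<And>u v. (u, v) \<in> parcs K \<Longrightarrow> (g u, g v) \<in> parcs M"
    "\<And>x. x \<in> pverts M \<Longrightarrow> \<sigma> x \<in> pverts K"
    "\<And>v. v \<in> pverts K \<Longrightarrow> \<sigma> (g v) = v"
    "\<And>x y. (x, y) \<in> parcs M \<Longrightarrow> \<sigma> x = \<sigma> y \<or> (\<sigma> x, \<sigma> y) \<in> parcs K"
    using assms(2) by (rule retract_embeddingE) blast
  show ?thesis
    by (rule retract_embeddingI[where \<rho> = "\<lambda>x. \<rho> (\<sigma> x)"]) (use \<rho> \<sigma> in \<open>simp_all, metis\<close>)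
qed

section \<open>Walks with stationary steps, and distances under non-expanding maps\<close>

lemma set_vwalk_arcs_map:
  "set (vwalk_arcs (map f p)) = (\<lambda>(x, y). (f x, f y)) ` set (vwalk_arcs p)"
  by (induction p rule: vwalk_arcs.induct) auto

lemma length_vwalk_to_vpath: "length (vwalk_to_vpath p) \<le> length p"
proof (induction p rule: vwalk_to_vpath.induct)
  case (2 x xs)
  then show ?case
    using length_dropWhile_le[of "\<lambda>y. y \<noteq> x" xs] by (cases "x \<in> set xs") force+
qed simp

lemma vwalk_remdups_adj:
  assumes "set p \<subseteq> verts G" "\<forall>(x, y) \<in> set (vwalk_arcs p). x = y \<or> (x, y) \<in> arcs_ends G" "p \<noteq> []"
  shows "vwalk (remdups_adj p) G"
  using assms
proof (induction p rule: remdups_adj.induct)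
  case (3 x y xs)
  show ?case
  proof (cases "x = y")
    case False
    moreover have "vwalk (remdups_adj (y # xs)) G"
      using 3(2)[OF False] "3.prems" by auto
    moreover have "(x, y) \<in> arcs_ends G"
      using "3.prems" False by auto
    ultimately show ?thesis
      using vwalk_consI[of "remdups_adj (y # xs)" G x] "3.prems" by (auto simp del: vwalk_arcs_Cons)
  qed (use 3 in auto)
qed (auto simp: vwalk_def)

text \<open>Deleting stationary steps and then cutting out closed detours turns \<open>p\<close>
  into a path with the same ends, and neither makes it longer.\<close>

lemma graph_dist_lazy_le:
  assumes "set p \<subseteq> pverts G" "\<forall>(x, y) \<in> set (vwalk_arcs p). x = y \<or> (x, y) \<in> parcs G" "p \<noteq> []"
  shows "graph_dist G (hd p) (last p) \<le> enat (vwalk_length p)"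
proof -
  define q where "q = vwalk_to_vpath (remdups_adj p)"
  have "vwalk (remdups_adj p) (with_proj G)"
    using assms by (intro vwalk_remdups_adj) auto
  then have "vpath q (with_proj G)" "hd q = hd p" "last q = last p"
    unfolding q_def by (auto intro: vwalk_to_vpath_vpath simp: vwalk_to_vpath_hd vwalk_to_vpath_last)
  moreover have "length q \<le> length p"
    unfolding q_def using length_vwalk_to_vpath remdups_adj_length le_trans by blast
  ultimately show ?thesis
    unfolding graph_dist_def by (intro INF_lower2[of q]) auto
qed

lemma graph_dist_le_map:
  assumes f: "\<And>x. x \<in> pverts G \<Longrightarrow> f x \<in> pverts K"
    and arc: "\<And>x y. (x, y) \<in> parcs G \<Longrightarrow> f x = f y \<or> (f x, f y) \<in> parcs K"
  shows "graph_dist K (f u) (f v) \<le> graph_dist G u v"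
  unfolding graph_dist_def[of G]
proof (rule INF_greatest)
  fix p assume "p \<in> {p. vpath p (with_proj G) \<and> hd p = u \<and> last p = v}"
  then have p: "set p \<subseteq> pverts G" "set (vwalk_arcs p) \<subseteq> parcs G" "p \<noteq> []" "hd p = u" "last p = v"
    by (auto simp: vpath_def vwalk_def)
  have "graph_dist K (hd (map f p)) (last (map f p)) \<le> enat (vwalk_length (map f p))"
    using p f arc by (intro graph_dist_lazy_le) (auto simp: set_vwalk_arcs_map, blast)
  then show "graph_dist K (f u) (f v) \<le> enat (vwalk_length p)"
    using p by (simp add: hd_map last_map)
qed

text \<open>Embedding and retraction are both non-expanding, which gives the two
  inequalities.\<close>

lemma graph_dist_retract_embedding:
  assumes "retract_embedding G K f" "u \<in> pverts G" "v \<in> pverts G"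
  shows "graph_dist G u v = graph_dist K (f u) (f v)"
proof -
  obtain \<rho> where \<rho>: "\<And>v. v \<in> pverts G \<Longrightarrow> f v \<in> pverts K"
    "\<And>u v. (u, v) \<in> parcs G \<Longrightarrow> (f u, f v) \<in> parcs K"
    "\<And>x. x \<in> pverts K \<Longrightarrow> \<rho> x \<in> pverts G"
    "\<And>v. v \<in> pverts G \<Longrightarrow> \<rho> (f v) = v"
    "\<And>x y. (x, y) \<in> parcs K \<Longrightarrow> \<rho> x = \<rho> y \<or> (\<rho> x, \<rho> y) \<in> parcs G"
    using assms(1) by (rule retract_embeddingE) blast
  have "graph_dist K (f u) (f v) \<le> graph_dist G u v"
    using \<rho> by (intro graph_dist_le_map) auto
  moreover have "graph_dist G (\<rho> (f u)) (\<rho> (f v)) \<le> graph_dist K (f u) (f v)"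
    using \<rho> by (intro graph_dist_le_map) auto
  ultimately show ?thesis
    using \<rho>(4) assms by auto
qed

section \<open>Making orientations homogeneous between levels\<close>

lemma pair_graphI:
  assumes "finite (pverts G)" "parcs G \<subseteq> pverts G \<times> pverts G" "sym (parcs G)" "irrefl (parcs G)"
  shows "pair_graph G"
proof -
  have "finite (parcs G)"
    using assms(1,2) finite_subset by blast
  then show ?thesis
    using assms by unfold_locales (auto simp: symmetric_def irrefl_def)
qed

lemma pair_graphD:
  assumes "pair_graph G"
  shows "finite (pverts G)" "parcs G \<subseteq> pverts G \<times> pverts G" "sym (parcs G)" "irrefl (parcs G)"
proof -
  interpret pair_graph G by fact
  show "finite (pverts G)" "parcs G \<subseteq> pverts G \<times> pverts G" "irrefl (parcs G)"
    using pair_finite_verts in_arcsD1 in_arcsD2 pair_no_loops by (auto simp: irrefl_def, blast)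
  show "sym (parcs G)"
    using pair_sym_arcs by (simp add: symmetric_def)
qed

text \<open>The two arcs may be exchanged, so the last implication is an equivalence. For distinct
  levels and an orientation \<open>D\<close> of a graph containing the copy, all copied edges
  between the levels point the same way.\<close>

definition homogeneous ::
  "'a pair_pre_digraph \<Rightarrow> ('a \<Rightarrow> nat) \<Rightarrow> ('a \<Rightarrow> 'b) \<Rightarrow> 'b pair_pre_digraph \<Rightarrow> nat \<Rightarrow> nat \<Rightarrow> bool" where
  "homogeneous G l f D i j \<longleftrightarrow>
     (\<forall>(u, v) \<in> parcs G. \<forall>(u', v') \<in> parcs G. l u = i \<longrightarrow> l v = j \<longrightarrow> l u' = i \<longrightarrow> l v' = j \<longrightarrow>
        (f u, f v) \<in> parcs D \<longrightarrow> (f u', f v') \<in> parcs D)"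

text \<open>The graph \<open>K\<close> is a union of copies of \<open>G\<close> inside a power of \<open>G\<close>, one for each Hales--Jewett
  line over the arcs between the levels \<open>i\<close> and \<open>j\<close>.  A coordinate projection at a variable position
  of a line retracts \<open>K\<close> onto the copy of that line: it maps any other copy either identically onto
  \<open>G\<close> or onto the two endpoints of a single edge.\<close>

lemma homogeneous_one_pair:
  fixes G :: "nat pair_pre_digraph"
  assumes G: "pair_graph G" and ij: "i \<noteq> j"
  shows "\<exists>(K :: nat pair_pre_digraph) l'. pair_graph K \<and> (\<forall>D. orientation K D \<longrightarrow>
           (\<exists>f. retract_embedding G K f \<and> (\<forall>v \<in> pverts G. l' (f v) = l v) \<and> homogeneous G l f D i j))"
proof -
  note Gs = pair_graphD[OF G]
  define E where "E = {(u, v) \<in> parcs G. l u = i \<and> l v = j}"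
  have "finite (parcs G)"
    using Gs(1,2) finite_subset by blast
  then have finE: "finite E"
    by (rule rev_finite_subset) (auto simp: E_def)
  obtain n where n: "\<And>\<chi>. (\<forall>w. \<chi> w < 2) \<Longrightarrow> mono_line E n \<chi>"
    using hales_jewett[OF finE] by blast
  \<comment> \<open>A fixed letter \<open>e\<close> sends vertices of level \<open>i\<close> to the
    end of \<open>e\<close> on that level and all others to its other end; a variable position keeps
    the vertex.\<close>
  define sub where "sub v = case_option v (\<lambda>e. if l v = i then fst e else snd e)" for v
  \<comment> \<open>Storing the level lets \<open>l'\<close> read it off the code. Copies share
    vertices when codes agree, so a point of a line over \<open>E\<close> names an edge of
    \<open>K\<close> independently of the line.\<close>
  define F where "F L v = to_nat (l v, map (sub v) L)" for L v
  define \<rho> where "\<rho> m x = (snd (from_nat x :: nat \<times> nat list)) ! m" for m x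
  define l' where "l' x = fst (from_nat x :: nat \<times> nat list)" for x
  define K where "K = \<lparr>pverts = (\<Union>L \<in> lines E n. F L ` pverts G),
    parcs = (\<Union>L \<in> lines E n. (\<lambda>(u, v). (F L u, F L v)) ` parcs G)\<rparr>"
  have \<rho>F: "\<rho> m (F L v) = sub v (L ! m)" if "L \<in> lines E n" "m < n" for m L v
    using that by (simp add: \<rho>_def F_def lines_def)
  have var: "\<exists>m < n. L ! m = None" if "L \<in> lines E n" for L
    using that by (auto simp: lines_def in_set_conv_nth)
  have letter: "L ! m = None \<or> (\<exists>e \<in> E. L ! m = Some e)" if "L \<in> lines E n" "m < n" for L m
  proof -
    have "L ! m \<in> set L"
      using that by (simp add: lines_def)
    moreover have "set L \<subseteq> insert None (Some ` E)"
      using that by (simp add: lines_def)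
    ultimately show ?thesis
      by blast
  qed
  have subv: "sub v (L ! m) \<in> pverts G" if "L \<in> lines E n" "m < n" "v \<in> pverts G" for L m v
    using letter[OF that(1,2)] that Gs(2) by (auto simp: sub_def E_def)
  have suba: "sub u (L ! m) = sub v (L ! m) \<or> (sub u (L ! m), sub v (L ! m)) \<in> parcs G"
    if "L \<in> lines E n" "m < n" "(u, v) \<in> parcs G" for L m u v
    using letter[OF that(1,2)]
  proof
    assume "\<exists>e \<in> E. L ! m = Some e"
    then obtain x y where "L ! m = Some (x, y)" "(x, y) \<in> parcs G"
      by (auto simp: E_def)
    then show ?thesis
      using symD[OF Gs(3)] by (simp add: sub_def)
  qed (simp add: sub_def that(3))
  have retr: "retract_embedding G K (F L)" if L: "L \<in> lines E n" for L
  proof -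
    obtain m where m: "m < n" "L ! m = None"
      using var[OF L] by blast
    show ?thesis
    proof (rule retract_embeddingI[where \<rho> = "\<rho> m"])
      show "F L v \<in> pverts K" if "v \<in> pverts G" for v
        using that L by (auto simp: K_def)
      show "(F L u, F L v) \<in> parcs K" if "(u, v) \<in> parcs G" for u v
        using that L by (force simp: K_def)
      show "\<rho> m (F L v) = v" for v
        using \<rho>F[OF L m(1)] m(2) by (simp add: sub_def)
      show "\<rho> m x \<in> pverts G" if "x \<in> pverts K" for x
        using that m(1) by (auto simp: K_def \<rho>F intro: subv)
      show "\<rho> m x = \<rho> m y \<or> (\<rho> m x, \<rho> m y) \<in> parcs G" if "(x, y) \<in> parcs K" for x y
        using that m(1) by (auto simp: K_def \<rho>F dest: suba)
    qed
  qed
  have "pair_graph K"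
  proof (rule pair_graphI)
    show "finite (pverts K)"
      using Gs(1) finite_lines[OF finE] by (auto simp: K_def)
    show "parcs K \<subseteq> pverts K \<times> pverts K"
      using Gs(2) by (force simp: K_def)
    show "sym (parcs K)"
      using Gs(3) by (force simp: K_def sym_def)
    show "irrefl (parcs K)"
      unfolding irrefl_def
    proof (intro allI notI)
      fix x assume "(x, x) \<in> parcs K"
      then obtain L u v where L: "L \<in> lines E n" "(u, v) \<in> parcs G" "F L u = F L v"
        by (auto simp: K_def)
      then have "u = v"
        using retract_embedding_inj_on[OF retr[OF L(1)]] Gs(2) by (auto dest: inj_onD)
      then show False
        using L Gs(4) by (auto simp: irrefl_def)
    qed
  qed
  moreover have "\<exists>f. retract_embedding G K f \<and> (\<forall>v \<in> pverts G. l' (f v) = l v) \<and> homogeneous G l f D i j"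
    for D
  proof -
    \<comment> \<open>A word over \<open>E\<close> is coloured by whether \<open>D\<close> points
      from its word of level-\<open>i\<close> ends to its word of level-\<open>j\<close>
      ends.\<close>
    define \<chi> :: "(nat \<times> nat) list \<Rightarrow> nat" where
      "\<chi> w = of_bool ((to_nat (i, map fst w), to_nat (j, map snd w)) \<in> parcs D)" for w
    have "\<forall>w. \<chi> w < 2"
      by (simp add: \<chi>_def)
    then obtain L c where L: "L \<in> lines E n" "\<And>e. e \<in> E \<Longrightarrow> \<chi> (inst e L) = c"
      using n unfolding mono_line_def by blast
    have colour: "(F L u, F L v) \<in> parcs D \<longleftrightarrow> c = 1" if "(u, v) \<in> E" for u v
    proof -
      \<comment> \<open>At a fixed \<open>e\<close> the vertex \<open>u\<close> gets
        \<open>fst e\<close>, and \<open>v\<close> gets \<open>snd e\<close> because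
        \<open>i \<noteq> j\<close>; at a variable both sides give \<open>u\<close> and
        \<open>v\<close>.\<close>
      have "F L u = to_nat (i, map fst (inst (u, v) L))" "F L v = to_nat (j, map snd (inst (u, v) L))"
        using that ij by (auto simp: F_def inst_def sub_def E_def split: option.splits)
      then show ?thesis
        using L(2)[OF that] by (auto simp: \<chi>_def of_bool_def split: if_splits)
    qed
    have "homogeneous G l (F L) D i j"
      using colour unfolding homogeneous_def E_def by auto
    moreover have "l' (F L v) = l v" for v
      by (simp add: l'_def F_def)
    ultimately show ?thesis
      using retr[OF L(1)] by blast
  qed
  ultimately show ?thesis
    by blast
qed

text \<open>Pairs are treated one at a time: \<open>G1\<close> settles the first for
  \<open>G\<close>, and \<open>K\<close> settles the rest for \<open>G1\<close>. Level-preserving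
  embeddings keep what has been achieved.\<close>

lemma homogeneous_pairs:
  fixes G :: "nat pair_pre_digraph"
  assumes "pair_graph G" "\<forall>(i, j) \<in> set ps. i \<noteq> j"
  shows "\<exists>K :: nat pair_pre_digraph. \<exists>l'. pair_graph K \<and> (\<forall>D. orientation K D \<longrightarrow>
           (\<exists>f. retract_embedding G K f \<and> (\<forall>v \<in> pverts G. l' (f v) = l v) \<and>
              (\<forall>(i, j) \<in> set ps. homogeneous G l f D i j)))"
  using assms
proof (induction ps arbitrary: G l)
  case Nil
  have "retract_embedding G G (\<lambda>v. v)"
    by (rule retract_embeddingI[where \<rho> = "\<lambda>v. v"]) auto
  then show ?case
    using Nil by (intro exI[of _ G] exI[of _ l]) auto
next
  case (Cons p ps)
  obtain i j where p: "p = (i, j)" "i \<noteq> j"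
    using Cons.prems by (cases p) auto
  obtain G1 :: "nat pair_pre_digraph" and l1 where G1: "pair_graph G1"
    "\<And>D. orientation G1 D \<Longrightarrow> \<exists>f. retract_embedding G G1 f \<and> (\<forall>v \<in> pverts G. l1 (f v) = l v) \<and> homogeneous G l f D i j"
    using homogeneous_one_pair[OF Cons.prems(1) p(2)] by metis
  obtain K :: "nat pair_pre_digraph" and l' where K: "pair_graph K"
    "\<And>D. orientation K D \<Longrightarrow> \<exists>f. retract_embedding G1 K f \<and> (\<forall>v \<in> pverts G1. l' (f v) = l1 v) \<and>
              (\<forall>(i, j) \<in> set ps. homogeneous G1 l1 f D i j)"
    using Cons.IH[OF G1(1), of l1] Cons.prems(2) by (metis (no_types, lifting) list.set_intros(2))
  have "\<exists>f. retract_embedding G K f \<and> (\<forall>v \<in> pverts G. l' (f v) = l v) \<and>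
              (\<forall>(i, j) \<in> set (p # ps). homogeneous G l f D i j)" if D: "orientation K D" for D
  proof -
    obtain g where g: "retract_embedding G1 K g" "\<And>v. v \<in> pverts G1 \<Longrightarrow> l' (g v) = l1 v"
      "\<And>i j. (i, j) \<in> set ps \<Longrightarrow> homogeneous G1 l1 g D i j"
      using K(2)[OF D] by blast
    \<comment> \<open>Pulling \<open>D\<close> back along \<open>g\<close> orients
      \<open>G1\<close>, so that the property of \<open>G1\<close> for \<open>(i, j)\<close>
      applies.\<close>
    define D1 where "D1 = \<lparr>pverts = pverts G1, parcs = {(u, v) \<in> parcs G1. (g u, g v) \<in> parcs D}\<rparr>"
    have garc: "(g u, g v) \<in> parcs K" if "(u, v) \<in> parcs G1" for u v
      using g(1) that by (auto simp: retract_embedding_def)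
    have "orientation G1 D1"
      using D garc pair_graphD(3)[OF G1(1)]
      unfolding orientation_def D1_def by (fastforce dest: symD)
    then obtain f where f: "retract_embedding G G1 f" "\<And>v. v \<in> pverts G \<Longrightarrow> l1 (f v) = l v"
      "homogeneous G l f D1 i j"
      using G1(2) by blast
    have fv: "f v \<in> pverts G1" if "v \<in> pverts G" for v
      using f(1) that by (auto simp: retract_embedding_def)
    have farc: "(f u, f v) \<in> parcs G1" if "(u, v) \<in> parcs G" for u v
      using f(1) that by (auto simp: retract_embedding_def)
    have D1: "(f u, f v) \<in> parcs D1 \<longleftrightarrow> (g (f u), g (f v)) \<in> parcs D" if "(u, v) \<in> parcs G" for u v
      using farc[OF that] by (simp add: D1_def)
    have lf: "l1 (f u) = l u" "l1 (f v) = l v" if "(u, v) \<in> parcs G" for u v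
      using f(2) pair_graphD(2)[OF Cons.prems(1)] that by auto
    have "homogeneous G l (\<lambda>v. g (f v)) D i j"
      using f(3) D1 unfolding homogeneous_def by fast
    moreover have "homogeneous G l (\<lambda>v. g (f v)) D i' j'" if "(i', j') \<in> set ps" for i' j'
    proof -
      have *: "(g (f u'), g (f v')) \<in> parcs D"
        if "(u, v) \<in> parcs G" "(u', v') \<in> parcs G" "l u = i'" "l v = j'" "l u' = i'" "l v' = j'"
          "(g (f u), g (f v)) \<in> parcs D" for u v u' v'
        using g(3)[OF \<open>(i', j') \<in> set ps\<close>] farc[OF that(1)] farc[OF that(2)] lf[OF that(1)] lf[OF that(2)] that
        unfolding homogeneous_def by fastforce
      show ?thesis
        unfolding homogeneous_def using * by blast
    qed
    ultimately show ?thesis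
      using retract_embedding_comp[OF f(1) g(1)] f(2) g(2) fv p
      by (intro exI[of _ "\<lambda>v. g (f v)"]) auto
  qed
  then show ?case
    using K(1) by blast
qed

section \<open>Linear orders from acyclic relations and tournaments\<close>

text \<open>A vertex \<open>x\<close> splits the others into successors and predecessors. One of
  these sets has at least \<open>2 ^ n\<close> elements, and \<open>x\<close> goes before or after
  the chain found there.\<close>

lemma transitive_subtournament:
  assumes "finite A" "2 ^ n \<le> card A"
    and "\<And>x y. x \<in> A \<Longrightarrow> y \<in> A \<Longrightarrow> x \<noteq> y \<Longrightarrow> T x y \<or> T y x"
  shows "\<exists>xs. length xs = n \<and> distinct xs \<and> set xs \<subseteq> A \<and> sorted_wrt T xs"
  using assms
proof (induction n arbitrary: A)
  case (Suc n)
  then have "A \<noteq> {}"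
    by auto
  then obtain x where x: "x \<in> A"
    by blast
  define B C where "B = {y \<in> A - {x}. T x y}" and "C = {y \<in> A - {x}. T y x}"
  have fin: "finite B" "finite C"
    using Suc.prems(1) by (auto simp: B_def C_def)
  have "insert x (B \<union> C) = A"
    using Suc.prems(3) x by (auto simp: B_def C_def)
  then have "card A \<le> Suc (card B + card C)"
    using card_Un_le[of B C] card_insert_le_m1 fin by (metis Suc_le_mono card_insert_if finite_UnI le_Suc_eq le_trans)
  then consider "2 ^ n \<le> card B" | "2 ^ n \<le> card C"
    using Suc.prems(2) by fastforce
  then show ?case
  proof cases
    case 1
    then obtain xs where "length xs = n" "distinct xs" "set xs \<subseteq> B" "sorted_wrt T xs"
      using Suc.IH[of B] fin Suc.prems(3) by (auto simp: B_def)
    then show ?thesis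
      using x by (intro exI[of _ "x # xs"]) (auto simp: B_def)
  next
    case 2
    then obtain xs where "length xs = n" "distinct xs" "set xs \<subseteq> C" "sorted_wrt T xs"
      using Suc.IH[of C] fin Suc.prems(3) by (auto simp: C_def)
    then show ?thesis
      using x by (intro exI[of _ "xs @ [x]"]) (auto simp: C_def sorted_wrt_append)
  qed
qed simp

text \<open>A finite acyclic relation is well-founded, so \<open>V\<close> has an
  \<open>R\<close>-minimal element, which can be listed first.\<close>

lemma topological_sort:
  assumes "finite V" "finite R" "acyclic R"
  shows "\<exists>vs. distinct vs \<and> set vs = V \<and> sorted_wrt (\<lambda>x y. (y, x) \<notin> R) vs"
  using assms(1)
proof (induction V rule: finite_psubset_induct)
  case (psubset V)
  show ?case
  proof (cases "V = {}")
    case False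
    then obtain x where x: "x \<in> V" "\<And>y. (y, x) \<in> R \<Longrightarrow> y \<notin> V"
      using finite_acyclic_wf[OF assms(2,3)] by (metis wfE_min ex_in_conv)
    then obtain vs where "distinct vs" "set vs = V - {x}" "sorted_wrt (\<lambda>x y. (y, x) \<notin> R) vs"
      using psubset.IH[of "V - {x}"] by auto
    then show ?thesis
      using x by (intro exI[of _ "x # vs"]) auto
  qed simp
qed

text \<open>A nontrivial closed walk contains a cycle, so excluding cycles also excludes closed
  walks.\<close>

lemma acyclic_parcs:
  assumes "finite_oriented_digraph H" "acyclic_digraph H"
  shows "acyclic (parcs H)"
proof -
  interpret pair_digraph H
    using assms by (simp add: finite_oriented_digraph_def)
  have "(u, u) \<notin> (parcs H)\<^sup>+" for u
    using assms(2) closed_w_imp_cycle reachable1_awalk[of u u]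
    unfolding acyclic_digraph_def closed_w_def by auto
  then show ?thesis
    by (simp add: acyclic_def)
qed

section \<open>The isometric Ramsey property\<close>

lemma isometric_arrow_acyclic:
  fixes H :: "'a pair_pre_digraph"
  assumes H: "finite_oriented_digraph H" and "acyclic_digraph H"
  shows "\<exists>G :: nat pair_pre_digraph. pair_graph G \<and> isometric_arrow G H"
proof -
  interpret H: pair_digraph H
    using H by (simp add: finite_oriented_digraph_def)
  define S where "S = mk_symmetric (with_proj H)"
  have "(u, v) \<in> parcs S \<longleftrightarrow> (u, v) \<in> parcs H \<or> (v, u) \<in> parcs H" for u v
    by (auto simp: S_def parcs_mk_symmetric intro: bexI[of _ "(v, u)"])
  moreover have "pverts S = pverts H"
    by (simp add: S_def)
  ultimately have S: "pverts S = pverts H"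
    "\<And>u v. (u, v) \<in> parcs S \<longleftrightarrow> (u, v) \<in> parcs H \<or> (v, u) \<in> parcs H"
    by blast+
  obtain vs where vs: "distinct vs" "set vs = pverts H" "sorted_wrt (\<lambda>x y. (y, x) \<notin> parcs H) vs"
    using topological_sort[OF H.pair_finite_verts H.pair_finite_arcs acyclic_parcs[OF assms]] by blast
  define a where "a = length vs"
  define r :: nat where "r = 2 ^ a"
  have "\<forall>v \<in> pverts H. \<exists>p. p < a \<and> vs ! p = v"
    unfolding vs(2)[symmetric] a_def by (simp add: in_set_conv_nth)
  \<comment> \<open>\<open>ix v\<close> is the place of \<open>v\<close> in the topological order;
    arcs of \<open>H\<close> run from smaller to larger places.\<close>
  then obtain ix where ix: "\<And>v. v \<in> pverts H \<Longrightarrow> ix v < a \<and> vs ! ix v = v"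
    by metis
  have ix_less: "ix u < ix v" if "(u, v) \<in> parcs H" for u v
  proof (rule ccontr)
    assume "\<not> ix u < ix v"
    moreover have "ix u \<noteq> ix v"
      using ix H.in_arcsD1[OF that] H.in_arcsD2[OF that] H.pair_no_loops[OF that] by (metis fst_conv snd_conv)
    ultimately show False
      using sorted_wrt_nth_less[OF vs(3), of "ix v" "ix u"] ix[OF H.in_arcsD1[OF that]]
        ix[OF H.in_arcsD2[OF that]] that by (auto simp: a_def)
  qed
  \<comment> \<open>Each \<open>xs\<close> in \<open>W\<close> is a placement: the vertex at place
    \<open>p\<close> goes to level \<open>xs ! p\<close>.\<close>
  define W where "W = {xs. set xs \<subseteq> {..<r} \<and> length xs = a \<and> distinct xs}"
  have finW: "finite W"
    unfolding W_def by (rule finite_subset[OF _ finite_lists_length_eq[of "{..<r}" a]]) auto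
  define F where "F xs v = to_nat (ix v, xs)" for v and xs :: "nat list"
  \<comment> \<open>Forgetting the label \<open>xs\<close> is one retraction that serves all the
    disjoint copies.\<close>
  define \<rho> where "\<rho> x = vs ! fst (from_nat x :: nat \<times> nat list)" for x
  define l where "l x = (case from_nat x :: nat \<times> nat list of (p, xs) \<Rightarrow> xs ! p)" for x
  define G where "G = \<lparr>pverts = (\<Union>xs \<in> W. F xs ` pverts H),
    parcs = (\<Union>xs \<in> W. (\<lambda>(u, v). (F xs u, F xs v)) ` parcs S)\<rparr>"
  have \<rho>F: "\<rho> (F xs v) = v" if "v \<in> pverts H" for xs v
    using ix[OF that] by (simp add: \<rho>_def F_def)
  have Sv: "u \<in> pverts H" "v \<in> pverts H" if "(u, v) \<in> parcs S" for u v
    using that H.wellformed' by (auto simp: S)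
  have retr: "retract_embedding S G (F xs)" if "xs \<in> W" for xs
    by (rule retract_embeddingI[where \<rho> = \<rho>])
      (use that in \<open>auto simp: G_def S(1) \<rho>F Sv image_iff split: prod.splits intro!: bexI[of _ xs]\<close>)
  have "pair_graph G"
  proof (rule pair_graphI)
    show "finite (pverts G)"
      using finW H.pair_finite_verts by (auto simp: G_def)
    show "parcs G \<subseteq> pverts G \<times> pverts G"
      using Sv by (force simp: G_def)
    show "sym (parcs G)"
      by (force simp: G_def sym_def S)
    show "irrefl (parcs G)"
      unfolding irrefl_def
    proof (intro allI notI)
      fix x assume "(x, x) \<in> parcs G"
      then obtain xs u v where uv: "(u, v) \<in> parcs S" "F xs u = F xs v"
        by (auto simp: G_def)
      then have "u = v"
        using \<rho>F Sv[OF uv(1)] by metis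
      then show False
        using uv(1) H.pair_no_loops[of "(u, u)"] by (simp add: S)
    qed
  qed
  define ps where "ps = filter (\<lambda>(i, j). i \<noteq> j) (List.product [0..<r] [0..<r])"
  obtain K :: "nat pair_pre_digraph" and l' where K: "pair_graph K"
    "\<And>D. orientation K D \<Longrightarrow> \<exists>f. retract_embedding G K f \<and> (\<forall>v \<in> pverts G. l' (f v) = l v) \<and>
              (\<forall>(i, j) \<in> set ps. homogeneous G l f D i j)"
    using homogeneous_pairs[OF \<open>pair_graph G\<close>, of ps l] by (auto simp: ps_def)
  have "isometric_arrow K H"
    unfolding isometric_arrow_def
  proof (intro allI impI)
    fix D assume D: "orientation K D"
    obtain f where f: "retract_embedding G K f" "\<And>i j. (i, j) \<in> set ps \<Longrightarrow> homogeneous G l f D i j"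
      using K(2)[OF D] by blast
    have garc: "(f u, f v) \<in> parcs K" if "(u, v) \<in> parcs G" for u v
      using f(1) that by (auto simp: retract_embedding_def)
    have anti: "(y, x) \<notin> parcs D" if "(x, y) \<in> parcs D" for x y
      using D that by (auto simp: orientation_def)
    have total: "(x, y) \<in> parcs D \<or> (y, x) \<in> parcs D" if "(x, y) \<in> parcs K" for x y
      using D that by (auto simp: orientation_def)
    \<comment> \<open>\<open>T\<close> holds both ways between levels that no edge joins, so it is
      total but need not be antisymmetric.\<close>
    define T where "T i j \<longleftrightarrow> (\<forall>(u, v) \<in> parcs G. l u = i \<longrightarrow> l v = j \<longrightarrow> (f u, f v) \<in> parcs D)" for i j
    have T: "T i j \<or> T j i" if "i \<in> {..<r}" "j \<in> {..<r}" "i \<noteq> j" for i j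
    proof (rule disjCI)
      \<comment> \<open>An edge violating \<open>T j i\<close> is directed from level
        \<open>i\<close> to level \<open>j\<close>, and homogeneity carries this to all edges
        between the two levels.\<close>
      assume "\<not> T j i"
      then obtain v u where vu: "(v, u) \<in> parcs G" "l v = j" "l u = i" "(f v, f u) \<notin> parcs D"
        by (auto simp: T_def)
      have uv: "(u, v) \<in> parcs G"
        using vu(1) pair_graphD(3)[OF \<open>pair_graph G\<close>] by (auto dest: symD)
      have "(f u, f v) \<in> parcs D"
        using total[OF garc[OF vu(1)]] vu by auto
      moreover have "homogeneous G l f D i j"
        using that by (intro f(2)) (auto simp: ps_def)
      ultimately show "T i j"
        using uv vu(2,3) unfolding homogeneous_def T_def by fast
    qed
    \<comment> \<open>The chain of levels is itself a placement in \<open>W\<close>, so one copy in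
      \<open>G\<close> sits on it in topological order.\<close>
    have "\<exists>xs. length xs = a \<and> distinct xs \<and> set xs \<subseteq> {..<r} \<and> sorted_wrt T xs"
      using T by (intro transitive_subtournament) (auto simp: r_def)
    then obtain xs where xs: "xs \<in> W" "length xs = a" "sorted_wrt T xs"
      by (auto simp: W_def)
    define g where "g v = f (F xs v)" for v
    have g: "retract_embedding S K g"
      unfolding g_def by (rule retract_embedding_comp[OF retr[OF xs(1)] f(1)])
    have g_arc: "(g u, g v) \<in> parcs D" if "(u, v) \<in> parcs H" for u v
    proof -
      have "T (xs ! ix u) (xs ! ix v)"
        using sorted_wrt_nth_less[OF xs(3) ix_less[OF that]] ix[OF H.in_arcsD2[OF that]] xs(2) by simp
      moreover have "(F xs u, F xs v) \<in> parcs G"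
        using xs(1) that by (force simp: G_def S)
      ultimately show ?thesis
        by (auto simp: T_def g_def l_def F_def)
    qed
    have g_arc_iff: "(u, v) \<in> parcs H \<longleftrightarrow> (g u, g v) \<in> parcs D"
      if uv: "u \<in> pverts H" "v \<in> pverts H" for u v
    proof
      \<comment> \<open>The copy is induced, so an extra arc of \<open>D\<close> would have to
        reverse an arc of \<open>H\<close>, which \<open>g_arc\<close> and \<open>anti\<close>
        exclude.\<close>
      assume gD: "(g u, g v) \<in> parcs D"
      then have gK: "(g u, g v) \<in> parcs K"
        using D by (auto simp: orientation_def)
      have "g u \<noteq> g v"
        using gK pair_graphD(4)[OF K(1)] by (auto simp: irrefl_def)
      then have "(u, v) \<in> parcs S"
        using retract_embedding_arcD[OF g _ _ gK] uv by (auto simp: S(1))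
      moreover have "(v, u) \<notin> parcs H"
        using g_arc anti[OF gD] by blast
      ultimately show "(u, v) \<in> parcs H"
        by (simp add: S)
    qed (rule g_arc)
    show "\<exists>f. f \<in> pverts H \<rightarrow> pverts K \<and> inj_on f (pverts H) \<and>
          (\<forall>u \<in> pverts H. \<forall>v \<in> pverts H. (u, v) \<in> parcs H \<longleftrightarrow> (f u, f v) \<in> parcs D) \<and>
          (\<forall>u \<in> pverts H. \<forall>v \<in> pverts H. digraph_dist H u v = graph_dist K (f u) (f v))"
    proof (intro exI[of _ g] conjI ballI)
      show "g \<in> pverts H \<rightarrow> pverts K"
        using g by (simp add: retract_embedding_def S)
      show "inj_on g (pverts H)"
        using retract_embedding_inj_on[OF g] by (simp add: S)
      show "digraph_dist H u v = graph_dist K (g u) (g v)" if "u \<in> pverts H" "v \<in> pverts H" for u v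
        unfolding digraph_dist_def S_def[symmetric]
        using that by (intro graph_dist_retract_embedding[OF g]) (simp_all add: S)
    qed (rule g_arc_iff)
  qed
  then show ?thesis
    using K(1) by blast
qed

theorem theorem2p1:
  fixes H :: "'a pair_pre_digraph"
  assumes "finite_oriented_digraph H"
    and "acyclic_digraph H"
  shows "IR H \<noteq> \<infinity> \<and> (\<exists>G :: nat pair_pre_digraph. pair_graph G \<and> isometric_arrow G H)"
proof -
  obtain G :: "nat pair_pre_digraph" where G: "pair_graph G" "isometric_arrow G H"
    using isometric_arrow_acyclic[OF assms] by blast
  then have "IR H \<le> enat (card (pverts G))"
    unfolding IR_def by (intro INF_lower) auto
  then have "IR H \<noteq> \<infinity>"
    by (cases "IR H") auto
  then show ?thesis
    using G by blast
qed

end
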